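(* Let $G_n$ and $H_n$ be the number of odd and even entries, respectively, in the first $n$ rows of the Pascal rhombus, i.e. the number of pairs $(i,k)$ of integers with $1\le i\le n$ and $-i<k<i$ for which $R[i,k]$ is odd, respectively even. Then $$\lim_{n\to\infty}\frac{G_n}{H_n}=0.$$
   Context: The Pascal rhombus is the array of integers $R[n,k]$ ($n\ge 0$ an integer row index, $k\in\mathbb{Z}$ a column index) defined by $R[0,j]=0$ for all $j$, $R[1,0]=1$, $R[1,j]=0$ for $j\neq 0$, and $R[n,k]=R[n-1,k-1]+R[n-1,k]+R[n-1,k+1]+R[n-2,k]$ for $n\ge 2$ and all $k$. The entries of row $n\ge1$ are the $2n-1$ entries with $-n<k<n$ (all entries outside this range are zero and are not counted). *)

theory Defs
  imports Complex_Main
begin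

fun pascal_rhombus :: "nat \<Rightarrow> int \<Rightarrow> int" where
  "pascal_rhombus 0 k = 0"
| "pascal_rhombus (Suc 0) k = (if k = 0 then 1 else 0)"
| "pascal_rhombus (Suc (Suc n)) k =
     pascal_rhombus (Suc n) (k - 1) + pascal_rhombus (Suc n) k
     + pascal_rhombus (Suc n) (k + 1) + pascal_rhombus n k"

definition rhombus_entries :: "nat \<Rightarrow> (nat \<times> int) set" where
  "rhombus_entries n = {(i, k). 1 \<le> i \<and> i \<le> n \<and> - int i < k \<and> k < int i}"

definition num_odd_entries :: "nat \<Rightarrow> nat" where
  "num_odd_entries n = card {(i, k) \<in> rhombus_entries n. odd (pascal_rhombus i k)}"

definition num_even_entries :: "nat \<Rightarrow> nat" where
  "num_even_entries n = card {(i, k) \<in> rhombus_entries n. even (pascal_rhombus i k)}"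

lemma finite_rhombus_entries: "finite (rhombus_entries n)"
proof (rule finite_subset)
  show "rhombus_entries n \<subseteq> {..n} \<times> {- int n..int n}"
    by (auto simp: rhombus_entries_def)
qed simp

text \<open>The quotient of the two counts is a genuine quotient for all large \<open>n\<close>:
  the third row is 1, 2, 4, 2, 1, so the denominator vanishes only for \<open>n < 3\<close>.\<close>

lemma num_even_entries_pos:
  assumes "n \<ge> 3"
  shows "num_even_entries n > 0"
proof -
  have "even (pascal_rhombus 3 0)"
    by (simp add: numeral_3_eq_3)
  then have "(3, 0) \<in> {(i, k) \<in> rhombus_entries n. even (pascal_rhombus i k)}"
    using assms by (simp add: rhombus_entries_def)
  moreover have "finite {(i, k) \<in> rhombus_entries n. even (pascal_rhombus i k)}"
    by (rule finite_subset[OF _ finite_rhombus_entries[of n]]) auto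
  ultimately show ?thesis
    unfolding num_even_entries_def using card_gt_0_iff by blast
qed

end

theory Submission
  imports Defs
begin

text \<open>
  Modulo 2, row \<open>n\<close> is the Fibonacci polynomial \<open>F\<^sub>n(t)\<close> at \<open>t = x\<^sup>-\<^sup>1 + 1 + x\<close>, and
  \<open>F\<^sub>2\<^sub>n = t F\<^sub>n\<^sup>2\<close>, \<open>F\<^sub>2\<^sub>n\<^sub>+\<^sub>1 = F\<^sub>n\<^sup>2 + F\<^sub>n\<^sub>+\<^sub>1\<^sup>2\<close>. Hence the parities of a 2 by 2 window at \<open>(n, k)\<close>
  determine those of the four windows at \<open>(2n + a, 2k + b)\<close> with \<open>a, b \<le> 1\<close>, through four linear
  maps of \<open>\<F>\<^sub>2\<^sup>4\<close>. A certain product of five of these maps is zero, so each 32-adic subdivision of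
  a square leaves at most 1023 of its 1024 subsquares with any odd entries. Thus the odd entries
  have density zero among all \<open>n\<^sup>2\<close> entries of the first \<open>n\<close> rows.
\<close>

section \<open>Parity rules under doubling\<close>

text \<open>Squaring modulo 2 moves column \<open>k\<close> to column \<open>2*k\<close>; the factor
  t in row \<open>2*n\<close> then fills the odd columns with sums of neighbours. The claims are
  proved jointly, since the recurrence mixes both row and column parities.\<close>

lemma even_pascal_rhombus_double:
  "(even (pascal_rhombus (2*n) (2*k)) \<longleftrightarrow> even (pascal_rhombus n k)) \<and>
   (even (pascal_rhombus (2*n) (2*k+1)) \<longleftrightarrow> even (pascal_rhombus n k + pascal_rhombus n (k+1))) \<and>
   (even (pascal_rhombus (Suc (2*n)) (2*k)) \<longleftrightarrow>
      even (pascal_rhombus n k + pascal_rhombus (Suc n) k)) \<and>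
   even (pascal_rhombus (Suc (2*n)) (2*k+1))"
proof (induction n arbitrary: k)
  case 0
  have "2*k + 1 \<noteq> 0" by presburger
  then show ?case by auto
next
  case (Suc n)
  let ?R = pascal_rhombus
  have IH1: "even (?R (2*n) (2*j)) = even (?R n j)"
    and IH2: "even (?R (2*n) (2*j+1)) = even (?R n j + ?R n (j+1))"
    and IH3: "even (?R (Suc (2*n)) (2*j)) = even (?R n j + ?R (Suc n) j)"
    and IH4: "even (?R (Suc (2*n)) (2*j+1))" for j
    using Suc.IH[of j] by blast+
  have IH3': "even (?R (Suc (2*n)) (2*j+1+1)) = even (?R n (j+1) + ?R (Suc n) (j+1))"
    and IH4': "even (?R (Suc (2*n)) (2*j-1))" for j
    using IH3[of "j+1"] IH4[of "j-1"] by (simp_all add: algebra_simps)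
  have rec: "?R (Suc (Suc i)) j = ?R (Suc i) (j-1) + ?R (Suc i) j + ?R (Suc i) (j+1) + ?R i j"
    for i j by (rule pascal_rhombus.simps(3))
  have row: "even (?R (Suc (Suc (2*n))) (2*j)) = even (?R (Suc n) j)"
    "even (?R (Suc (Suc (2*n))) (2*j+1)) = even (?R (Suc n) j + ?R (Suc n) (j+1))" for j
  proof -
    show "even (?R (Suc (Suc (2*n))) (2*j)) = even (?R (Suc n) j)"
      unfolding rec[of "2*n"] even_add
      using IH1[of j] IH3[of j] IH4[of j] IH4'[of j] unfolding even_add by argo
    show "even (?R (Suc (Suc (2*n))) (2*j+1)) = even (?R (Suc n) j + ?R (Suc n) (j+1))"
      unfolding rec[of "2*n"] even_add add_diff_cancel_right'
      using IH2[of j] IH3[of j] IH4[of j] IH3'[of j] unfolding even_add by argo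
  qed
  have row': "even (?R (Suc (Suc (2*n))) (2*j+1+1)) = even (?R (Suc n) (j+1))"
    "even (?R (Suc (Suc (2*n))) (2*j-1)) = even (?R (Suc n) (j-1) + ?R (Suc n) j)" for j
  proof -
    have "2*(j+1) = 2*j+1+1" "2*(j-1)+1 = 2*j-1" "j-1+1 = j" by simp_all
    then show "even (?R (Suc (Suc (2*n))) (2*j+1+1)) = even (?R (Suc n) (j+1))"
      "even (?R (Suc (Suc (2*n))) (2*j-1)) = even (?R (Suc n) (j-1) + ?R (Suc n) j)"
      using row(1)[of "j+1"] row(2)[of "j-1"] by metis+
  qed
  have "even (?R (Suc (Suc (Suc (2*n)))) (2*k)) = even (?R (Suc n) k + ?R (Suc (Suc n)) k)"
    unfolding rec[of "Suc (2*n)"] rec[of n] even_add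
    using row[of k] row'[of k] IH3[of k] unfolding even_add by argo
  moreover have "even (?R (Suc (Suc (Suc (2*n)))) (2*k+1))"
    unfolding rec[of "Suc (2*n)"] even_add add_diff_cancel_right'
      row row' using IH4[of k] unfolding even_add by blast
  moreover have "2 * Suc n = Suc (Suc (2*n))" by simp
  ultimately show ?case using row[of k] by metis
qed

section \<open>Windows and their refinement\<close>

definition even_window :: "nat \<Rightarrow> int \<Rightarrow> bool" where
  "even_window n k \<longleftrightarrow> even (pascal_rhombus n k) \<and> even (pascal_rhombus n (k+1)) \<and>
     even (pascal_rhombus (Suc n) k) \<and> even (pascal_rhombus (Suc n) (k+1))"

text \<open>The 3 by 3 array at \<open>(2*n, 2*k)\<close> contains all four refined windows. As
  \<open>R\<close> means evenness, \<open>=\<close> between its values is addition modulo 2.\<close>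

lemma window_parities:
  fixes n :: nat and k :: int
  defines "R \<equiv> \<lambda>i j. even (pascal_rhombus i j)"
  shows "R (2*n) (2*k) = R n k" "R (2*n) (2*k+1) = (R n k = R n (k+1))"
    "R (2*n) (2*k+2) = R n (k+1)"
    "R (2*n+1) (2*k) = (R n k = R (n+1) k)" "R (2*n+1) (2*k+1)"
    "R (2*n+1) (2*k+2) = (R n (k+1) = R (n+1) (k+1))"
    "R (2*n+2) (2*k) = R (n+1) k" "R (2*n+2) (2*k+1) = (R (n+1) k = R (n+1) (k+1))"
    "R (2*n+2) (2*k+2) = R (n+1) (k+1)"
proof -
  have "2 * Suc n = 2*n+2" "2*(k+1) = 2*k+2" "Suc (2*n) = 2*n+1" "Suc n = n+1" by simp_all
  then show "R (2*n) (2*k) = R n k" "R (2*n) (2*k+1) = (R n k = R n (k+1))"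
    "R (2*n) (2*k+2) = R n (k+1)"
    "R (2*n+1) (2*k) = (R n k = R (n+1) k)" "R (2*n+1) (2*k+1)"
    "R (2*n+1) (2*k+2) = (R n (k+1) = R (n+1) (k+1))"
    "R (2*n+2) (2*k) = R (n+1) k" "R (2*n+2) (2*k+1) = (R (n+1) k = R (n+1) (k+1))"
    "R (2*n+2) (2*k+2) = R (n+1) (k+1)"
    using even_pascal_rhombus_double[of n k] even_pascal_rhombus_double[of n "k+1"]
      even_pascal_rhombus_double[of "Suc n" k] even_pascal_rhombus_double[of "Suc n" "k+1"]
    unfolding R_def even_add by metis+
qed

text \<open>The refinement maps are linear, so the zero window refines to zero windows only.\<close>

lemma even_window_refine:
  assumes "even_window (n div 2) (k div 2)"
  shows "even_window n k"
proof -
  have "n = 2 * (n div 2) \<or> n = 2 * (n div 2) + 1" "k = 2 * (k div 2) \<or> k = 2 * (k div 2) + 1"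
    by presburger+
  then obtain m l where ml: "m = n div 2" "l = k div 2"
    and n: "n = 2*m \<or> n = 2*m+1" and k: "k = 2*l \<or> k = 2*l+1" by blast
  have "even_window m l" using assms ml by simp
  then have "even_window (2*m) (2*l)" "even_window (2*m) (2*l+1)"
    "even_window (2*m+1) (2*l)" "even_window (2*m+1) (2*l+1)"
    using window_parities[of m l] by (simp_all add: even_window_def add.assoc)
  then show ?thesis using n k by auto
qed

lemma even_window_refine_power:
  "even_window (n div 2^p) (k div 2^p) \<Longrightarrow> even_window n k"
proof (induction p)
  case (Suc p)
  have "n div 2^Suc p = n div 2^p div 2" "k div 2^Suc p = k div 2^p div 2"
    by (simp_all add: div_mult2_eq zdiv_zmult2_eq mult.commute[of 2])
  then show ?case using Suc even_window_refine by metis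
qed simp

text \<open>The annihilating product: the row offset 9 = 01001 and the column offset 14 = 01110 in binary
  encode the successive subwindows (0,0), (1,1), (0,1), (0,1), (1,0).\<close>

lemma even_window_in_block: "even_window (32*n+9) (32*k+14)"
proof -
  define n1 n2 n3 n4 where n_defs: "n1 = 2*n" "n2 = 2*n1+1" "n3 = 2*n2" "n4 = 2*n3"
  define k1 k2 k3 k4 where k_defs: "k1 = 2*k" "k2 = 2*k1+1" "k3 = 2*k2+1" "k4 = 2*k3+1"
  let ?E = "\<lambda>i j. even (pascal_rhombus i j)"
  have "?E (n1+1) (k1+1)"
    using window_parities(5)[of n k] by (simp add: n_defs(1) k_defs(1))
  then have "?E n2 k2" "?E (n2+1) (k2+1)"
    using window_parities[of n1 k1] by (simp_all add: n_defs(2) k_defs(2) add.assoc)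
  \<comment> \<open>One bit of freedom remains: modulo 2 the window has rows (x, x) and (0, x), x
    being the entry at \<open>(n2, k2+1)\<close>.\<close>
  then have "?E n3 k3 = ?E n3 (k3+1)" "?E (n3+1) k3" "?E (n3+1) (k3+1) = ?E n3 (k3+1)"
    using window_parities[of n2 k2] by (auto simp add: n_defs(3) k_defs(3) add.assoc)
  \<comment> \<open>Only the top right entry may still be odd, and the last map does not read
    it.\<close>
  then have "?E n4 k4" "?E (n4+1) k4" "?E (n4+1) (k4+1)"
    using window_parities[of n3 k3] by (auto simp add: n_defs(4) k_defs(4) add.assoc)
  then have "even_window (2*n4+1) (2*k4)"
    using window_parities[of n4 k4] by (simp add: even_window_def add.assoc)
  moreover have "2*n4+1 = 32*n+9" "2*k4 = 32*k+14"
    by (simp_all add: n_defs k_defs)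
  ultimately show ?thesis by metis
qed

section \<open>Counting odd entries in blocks\<close>

text \<open>Quotients make subdivision an iterated division; \<open>div\<close> rounds down, so
  negative columns are tiled as well.\<close>

definition block :: "nat \<Rightarrow> nat \<Rightarrow> int \<Rightarrow> (nat \<times> int) set" where
  "block s n k = {(i, j). i div s = n \<and> j div int s = k}"

definition odd_block :: "nat \<Rightarrow> nat \<Rightarrow> int \<Rightarrow> (nat \<times> int) set" where
  "odd_block s n k = {(i, j) \<in> block s n k. odd (pascal_rhombus i j)}"

lemma block_eq:
  assumes "s > 0"
  shows "block s n k = {s*n..<s*n+s} \<times> {int s*k..<int s*k+int s}"
proof -
  have "i div s = n \<longleftrightarrow> s*n \<le> i \<and> i < s*n+s" for i
    using assms div_nat_eqI[of s n i] times_div_less_eq_dividend[of s i]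
      dividend_less_times_div[of s i] by auto
  moreover have "j div int s = k \<longleftrightarrow> int s*k \<le> j \<and> j < int s*k+int s" for j
  proof
    assume "j div int s = k"
    then have "int s*k + j mod int s = j" by (metis mult_div_mod_eq)
    moreover have "0 \<le> j mod int s" "j mod int s < int s" using assms by simp_all
    ultimately show "int s*k \<le> j \<and> j < int s*k+int s" by linarith
  next
    assume "int s*k \<le> j \<and> j < int s*k+int s"
    then show "j div int s = k"
      by (intro int_div_pos_eq[where r = "j - int s*k"]) auto
  qed
  ultimately show ?thesis by (auto simp: block_def)
qed

lemma finite_odd_block: "s > 0 \<Longrightarrow> finite (odd_block s n k)"
  by (rule finite_subset[of _ "block s n k"]) (auto simp: odd_block_def block_eq)

text \<open>Of the 1024 subblocks of side \<open>32^m\<close>, the one with index \<open>z\<close>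
  has no odd entries; the induction hypothesis bounds each of the other 1023.\<close>

lemma card_odd_block: "card (odd_block (32^m) n k) \<le> 1023^m"
proof (induction m arbitrary: n k)
  case 0
  have "card (odd_block 1 n k) \<le> card (block 1 n k)"
    by (rule card_mono) (auto simp: block_eq odd_block_def)
  then show ?case by (simp add: block_eq)
next
  case (Suc m)
  define s :: nat where "s = 32^m"
  have s: "s > 0" "s = 2^(5*m)" by (simp_all add: s_def power_mult)
  define z where "z = (32*n+9, 32*k+14)"
  define I where "I = block 32 n k - {z}"
  have z: "z \<in> block 32 n k" by (simp add: z_def block_eq)
  have fin: "finite (block 32 n k)" and card: "card (block 32 n k) = 1024"
    by (simp_all add: block_eq)
  have "odd_block (32 * s) n k \<subseteq> (\<Union>(a,b)\<in>I. odd_block s a b)"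
  proof safe
    fix i j assume ij: "(i,j) \<in> odd_block (32*s) n k"
    have "(i div s, j div int s) \<noteq> z"
    proof
      assume "(i div s, j div int s) = z"
      \<comment> \<open>The window at the coarse index is zero, and this passes down through
        \<open>5*m\<close> halvings to \<open>(i, j)\<close>.\<close>
      then have "even_window (i div 2^(5*m)) (j div 2^(5*m))"
        using even_window_in_block[of n k] s by (simp add: z_def)
      from even_window_refine_power[OF this] have "even (pascal_rhombus i j)"
        by (simp add: even_window_def)
      then show False using ij by (simp add: odd_block_def)
    qed
    moreover have "(i div s, j div int s) \<in> block 32 n k"
      "(i,j) \<in> odd_block s (i div s) (j div int s)"
      using ij s(1)
      by (auto simp: odd_block_def block_def div_mult2_eq zdiv_zmult2_eq mult.commute[of 32])
    ultimately show "(i,j) \<in> (\<Union>(a,b)\<in>I. odd_block s a b)"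
      unfolding I_def by blast
  qed
  then have "card (odd_block (32 * s) n k) \<le> card (\<Union>(a,b)\<in>I. odd_block s a b)"
    using fin s by (intro card_mono) (auto simp: I_def intro: finite_odd_block)
  also have "\<dots> \<le> (\<Sum>x\<in>I. card (case x of (a,b) \<Rightarrow> odd_block s a b))"
    using fin by (intro card_UN_le) (simp add: I_def)
  also have "\<dots> \<le> (\<Sum>x\<in>I. 1023^m)"
    using Suc.IH by (intro sum_mono) (auto simp: s_def)
  also have "\<dots> = 1023^Suc m"
    using z card fin by (simp add: I_def)
  finally show ?case by (simp add: s_def)
qed

text \<open>The first \<open>n\<close> rows are covered by O(\<open>q^2\<close>) blocks of side
  \<open>32^m\<close>, where \<open>q * 32^m\<close> is at most \<open>n\<close>.\<close>

lemma num_odd_entries_le: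
  assumes "32^m \<le> n"
  shows "real (num_odd_entries n) \<le> 8 * (1023/1024)^m * real n ^ 2"
proof -
  define s :: nat where "s = 32^m"
  have s: "s > 0" by (simp add: s_def)
  define q where "q = n div s"
  have q: "q \<ge> 1" using assms s by (simp add: q_def s_def div_greater_zero_iff Suc_le_eq)
  \<comment> \<open>Rounding down can give the leftmost columns the quotient
    \<open>-int q-1\<close>.\<close>
  define I where "I = {..q} \<times> {-int q-1..int q}"
  have "{(i, k) \<in> rhombus_entries n. odd (pascal_rhombus i k)} \<subseteq> (\<Union>(a,b)\<in>I. odd_block s a b)"
  proof safe
    fix i k assume ik: "(i,k) \<in> rhombus_entries n" and odd: "odd (pascal_rhombus i k)"
    have "i div s \<le> q" using ik by (auto simp: q_def rhombus_entries_def intro: div_le_mono)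
    moreover have "k div int s \<le> int n div int s" 
      using ik s by (intro zdiv_mono1) (auto simp: rhombus_entries_def)
    then have "k div int s \<le> int q" by (simp add: q_def zdiv_int)
    moreover have "-int q-1 \<le> k div int s"
    proof -
      have "n < s * (q + 1)" using s by (simp add: q_def dividend_less_times_div)
      then have "int n < int s * (int q + 1)"
        by (metis of_nat_less_iff of_nat_mult of_nat_add of_nat_1)
      moreover have "- int n \<le> k" using ik by (auto simp: rhombus_entries_def)
      ultimately have "(-int q-1) * int s \<le> k" by (simp add: algebra_simps)
      then show ?thesis using s zdiv_mono1[of "(-int q-1) * int s" k "int s"] by simp
    qed
    ultimately have "(i div s, k div int s) \<in> I" by (simp add: I_def)
    moreover have "(i,k) \<in> odd_block s (i div s) (k div int s)"
      using odd by (simp add: odd_block_def block_def)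
    ultimately show "(i,k) \<in> (\<Union>(a,b)\<in>I. odd_block s a b)" by blast
  qed
  then have "num_odd_entries n \<le> card (\<Union>(a,b)\<in>I. odd_block s a b)"
    unfolding num_odd_entries_def
    using s by (intro card_mono) (auto simp: I_def intro: finite_odd_block)
  also have "\<dots> \<le> (\<Sum>x\<in>I. card (case x of (a,b) \<Rightarrow> odd_block s a b))"
    by (intro card_UN_le) (simp add: I_def)
  also have "\<dots> \<le> (\<Sum>x\<in>I. 1023^m)"
    using card_odd_block by (intro sum_mono) (auto simp: s_def)
  also have "\<dots> = (q+1) * (2*q+2) * 1023^m"
  proof -
    have "card {-int q-1..int q} = 2*q+2" by simp
    then show ?thesis by (simp only: I_def card_cartesian_product sum_constant card_atMost) simp
  qed
  \<comment> \<open>Here \<open>q \<ge> 1\<close>, which comes from \<open>32^m \<le> n\<close>,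
    absorbs the boundary blocks into the constant 8.\<close>
  also have "\<dots> \<le> (2*q) * (4*q) * 1023^m"
    using q by (intro mult_mono) auto
  finally have "real (num_odd_entries n) \<le> real ((2*q) * (4*q) * 1023^m)"
    using of_nat_le_iff by blast
  also have "\<dots> = 8 * (1023/1024)^m * (real q * 32^m)^2"
  proof -
    have "((32::real)^m)^2 = 1024^m"
      by (simp add: power2_eq_square flip: power_mult_distrib)
    then have "(1023/1024)^m * ((32::real)^m)^2 = 1023^m"
      by (simp add: power_divide)
    then have "8 * real q ^ 2 * ((1023/1024)^m * ((32::real)^m)^2) = 8 * real q ^ 2 * 1023^m"
      by (rule arg_cong)
    moreover have "real ((2*q) * (4*q) * 1023^m) = 8 * real q ^ 2 * 1023^m"
      by (simp add: power2_eq_square)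
    ultimately show ?thesis by (simp only: power_mult_distrib mult_ac)
  qed
  also have "\<dots> \<le> 8 * (1023/1024)^m * real n ^ 2"
  proof -
    have "q * s \<le> n" by (simp add: q_def)
    then have "real q * 32^m \<le> real n"
      by (metis of_nat_le_iff of_nat_mult of_nat_numeral of_nat_power s_def)
    then show ?thesis by (intro mult_left_mono power_mono) auto
  qed
  finally show ?thesis .
qed

section \<open>Passage to the limit\<close>

text \<open>The row lengths are the first \<open>n\<close> odd numbers.\<close>

lemma num_odd_plus_even: "num_odd_entries n + num_even_entries n = n^2"
proof -
  have "num_odd_entries n + num_even_entries n = card (rhombus_entries n)"
    unfolding num_odd_entries_def num_even_entries_def
    by (subst card_Un_disjoint[symmetric])
      (blast intro: arg_cong[where f = card] finite_subset[OF _ finite_rhombus_entries[of n]])+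
  also have "rhombus_entries n = Sigma {1..n} (\<lambda>i. {-int i<..<int i})"
    by (auto simp: rhombus_entries_def)
  also have "card \<dots> = (\<Sum>i=1..n. 2*i-1)"
    by (subst card_SigmaI) (auto intro!: sum.cong)
  also have "\<dots> = n^2"
    by (induction n) (auto simp: power2_eq_square)
  finally show ?thesis .
qed

text \<open>First \<open>m\<close> is chosen from \<open>e\<close>; the resulting bound is then
  uniform in all \<open>n \<ge> 32^m\<close>.\<close>

lemma odd_density_tendsto_0: "(\<lambda>n. real (num_odd_entries n) / real n ^ 2) \<longlonglongrightarrow> 0"
proof (rule LIMSEQ_I)
  fix e :: real assume "e > 0"
  then obtain m where m: "(1023/1024)^m < e / 8"
    using real_arch_pow_inv[of "e/8" "1023/1024"] by auto
  have "norm (real (num_odd_entries n) / real n ^ 2 - 0) < e" if n: "32^m \<le> n" for n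
  proof -
    have "n > 0" using n by (metis gr0I le_zero_eq power_not_zero zero_neq_numeral)
    then have "real (num_odd_entries n) / real n ^ 2 \<le> 8 * (1023/1024)^m"
      using num_odd_entries_le[OF n] by (simp add: divide_le_eq)
    then show ?thesis using m by simp
  qed
  then show "\<exists>N. \<forall>n\<ge>N. norm (real (num_odd_entries n) / real n ^ 2 - 0) < e" by blast
qed

theorem mainTheorem4:
  shows "(\<lambda>n. real (num_odd_entries n) / real (num_even_entries n)) \<longlonglongrightarrow> 0"
proof -
  let ?g = "\<lambda>n. real (num_odd_entries n) / real n ^ 2"
  \<comment> \<open>Dividing both counts by \<open>n^2\<close> turns the quotient into g/(1-g),
    since the even density is 1-g.\<close>
  have "(\<lambda>n. ?g n / (1 - ?g n)) \<longlonglongrightarrow> 0 / (1 - 0)"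
    by (intro tendsto_intros odd_density_tendsto_0) simp
  moreover have "\<forall>\<^sub>F n in sequentially.
      ?g n / (1 - ?g n) = real (num_odd_entries n) / real (num_even_entries n)"
    using eventually_gt_at_top[of 0]
  proof eventually_elim
    case (elim n)
    have "real (num_odd_entries n) + real (num_even_entries n) = real n ^ 2"
      by (metis num_odd_plus_even of_nat_add of_nat_power)
    then have "1 - ?g n = real (num_even_entries n) / real n ^ 2"
      using elim by (simp add: field_simps)
    then show ?case using elim by simp
  qed
  ultimately have "(\<lambda>n. real (num_odd_entries n) / real (num_even_entries n)) \<longlonglongrightarrow> 0 / (1 - 0)"
    by (rule Lim_transform_eventually)
  then show ?thesis by simp
qed

end
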